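(* Let $\lambda$ be a nonzero real number and $Y$ a random variable as in the context. For all integers $n\ge k\ge0$, \[ S_{1,\lambda}^{Y}(n,k)=\sum_{j=0}^{n-k}\binom{n+j-1}{n+j-k}\binom{2n-k}{n-k-j}(-1)^{j}E[Y]^{-n-j}S_{2,\lambda}^{Y}(n-k+j,j). \]
   Context: $(x)_{0,\lambda}=1$, $(x)_{n,\lambda}=x(x-\lambda)\cdots(x-(n-1)\lambda)$ for $n\ge1$. $Y$ is a random variable whose moment-generating function $E[e^{tY}]$ exists for $|t|<r$ for some $r>0$, and $E[Y]\neq0$. $E[e_{\lambda}^{Y}(t)]$ denotes the formal power series $\sum_{n\ge0}E[(Y)_{n,\lambda}]\frac{t^n}{n!}$. The probabilistic degenerate Stirling numbers of the second kind: $\frac1{k!}\big(E[e_{\lambda}^{Y}(t)]-1\big)^k=\sum_{n\ge k}S_{2,\lambda}^{Y}(n,k)\frac{t^n}{n!}$. Let $e_{Y,\lambda}(t)=E[e_{\lambda}^{Y}(t)]-1$ (a delta series, linear coefficient $E[Y]\ne0$) and $\bar e_{Y,\lambda}(t)$ its compositional inverse; the probabilistic degenerate Stirling numbers of the first kind: $\frac1{k!}\big(\bar e_{Y,\lambda}(t)\big)^k=\sum_{n\ge k}S_{1,\lambda}^{Y}(n,k)\frac{t^n}{n!}$ ($k\ge0$). *)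

theory Defs
  imports "HOL-Probability.Probability" "HOL-Computational_Algebra.Formal_Power_Series"
begin

definition degen_ffact :: "real \<Rightarrow> real \<Rightarrow> nat \<Rightarrow> real" where
  "degen_ffact lam x n = (\<Prod>i<n. x - of_nat i * lam)"

definition degen_mgf_fps :: "'a measure \<Rightarrow> real \<Rightarrow> ('a \<Rightarrow> real) \<Rightarrow> real fps" where
  "degen_mgf_fps M lam Y = Abs_fps (\<lambda>n. (LINT \<omega>|M. degen_ffact lam (Y \<omega>) n) / fact n)"

definition degen_delta :: "'a measure \<Rightarrow> real \<Rightarrow> ('a \<Rightarrow> real) \<Rightarrow> real fps" where
  "degen_delta M lam Y = degen_mgf_fps M lam Y - 1"

text \<open>The Stirling numbers are read off as exponential coefficients of their generating
  series; the lemmas below recover the defining identities.\<close>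

definition prob_degen_stirling2 ::
    "'a measure \<Rightarrow> real \<Rightarrow> ('a \<Rightarrow> real) \<Rightarrow> nat \<Rightarrow> nat \<Rightarrow> real" where
  "prob_degen_stirling2 M lam Y n k =
     fact n * fps_nth (fps_const (1 / fact k) * degen_delta M lam Y ^ k) n"

definition prob_degen_stirling1 ::
    "'a measure \<Rightarrow> real \<Rightarrow> ('a \<Rightarrow> real) \<Rightarrow> nat \<Rightarrow> nat \<Rightarrow> real" where
  "prob_degen_stirling1 M lam Y n k =
     fact n * fps_nth (fps_const (1 / fact k) * fps_inv (degen_delta M lam Y) ^ k) n"

lemma degen_delta_nth_0: "prob_space M \<Longrightarrow> fps_nth (degen_delta M lam Y) 0 = 0"
  by (simp add: degen_delta_def degen_mgf_fps_def degen_ffact_def prob_space.prob_space)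

lemma degen_delta_nth_1: "fps_nth (degen_delta M lam Y) 1 = (LINT \<omega>|M. Y \<omega>)"
  by (simp add: degen_delta_def degen_mgf_fps_def degen_ffact_def)

lemma fps_inv_degen_delta:
  assumes "prob_space M" "(LINT \<omega>|M. Y \<omega>) \<noteq> 0"
  shows "fps_compose (fps_inv (degen_delta M lam Y)) (degen_delta M lam Y) = fps_X"
    and "fps_compose (degen_delta M lam Y) (fps_inv (degen_delta M lam Y)) = fps_X"
  using assms degen_delta_nth_0[of M lam Y] degen_delta_nth_1[of M lam Y]
  by (simp_all add: fps_inv fps_inv_right)

lemma prob_degen_stirling2_gf:
  assumes "prob_space M"
  shows "fps_const (1 / fact k) * degen_delta M lam Y ^ k =
    Abs_fps (\<lambda>n. if k \<le> n then prob_degen_stirling2 M lam Y n k / fact n else 0)"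
  using startsby_zero_power_prefix[OF degen_delta_nth_0[OF assms], of k]
  by (auto simp: fps_eq_iff prob_degen_stirling2_def)

lemma prob_degen_stirling1_gf:
  "fps_const (1 / fact k) * fps_inv (degen_delta M lam Y) ^ k =
    Abs_fps (\<lambda>n. if k \<le> n then prob_degen_stirling1 M lam Y n k / fact n else 0)"
proof -
  have "fps_nth (fps_inv (degen_delta M lam Y)) 0 = 0" by (simp add: fps_inv_def)
  from startsby_zero_power_prefix[OF this, of k] show ?thesis
    by (auto simp: fps_eq_iff prob_degen_stirling1_def)
qed

end

theory Submission
  imports Defs
begin

text \<open>
  The identity is Schloemilch's formula for an arbitrary delta series \<open>f = a X u\<close> with
  \<open>u(0) = 1\<close>. Lagrange inversion gives
  \<open>n [X\<^sup>n] g\<^sup>k = k a\<^sup>-\<^sup>n [X\<^sup>n\<^sup>-\<^sup>k] u\<^sup>-\<^sup>n\<close> for the compositional inverse \<open>g\<close> of \<open>f\<close>.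
  Expanding \<open>u\<^sup>-\<^sup>n = (1 - (1 - u))\<^sup>-\<^sup>n\<close> by the negative binomial series,
  which may be cut off at degree \<open>n - k\<close>, and then each \<open>(1 - u)\<^sup>i\<close> by the binomial theorem
  writes the coefficient as a combination of the coefficients of \<open>u\<^sup>j\<close>, \<open>j \<le> n - k\<close>, i.e. of \<open>f\<^sup>j\<close>.
\<close>

unbundle no vec_syntax
unbundle fps_syntax

text \<open>Without constant term, \<open>b ^ i\<close> starts in degree \<open>i\<close>, so one
  cut-off \<open>i \<le> n\<close> serves every coefficient of the composite up to degree
  \<open>n\<close>, and the sum can be pulled out of the convolution.\<close>

lemma fps_compose_mult_nth:
  fixes a b c :: "'a::comm_ring_1 fps"
  assumes "b $ 0 = 0"
  shows "((a oo b) * c) $ n = (\<Sum>i=0..n. a $ i * (b ^ i * c) $ n)"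
proof -
  have "(a oo b) $ j = (\<Sum>i=0..n. a $ i * (b ^ i) $ j)" if "j \<le> n" for j
    unfolding fps_compose_nth using that startsby_zero_power_prefix[OF assms]
    by (intro sum.mono_neutral_left) auto
  then have "((a oo b) * c) $ n = (\<Sum>j=0..n. \<Sum>i=0..n. a $ i * (b ^ i) $ j * c $ (n - j))"
    by (simp add: fps_mult_nth sum_distrib_right)
  also have "\<dots> = (\<Sum>i=0..n. a $ i * (b ^ i * c) $ n)"
    by (subst sum.swap) (simp add: fps_mult_nth sum_distrib_left mult.assoc)
  finally show ?thesis .
qed

text \<open>With f = X u this is the formal residue of f' / f^(m+1). For m > 0 that quotient is the
  derivative of the Laurent series -f^(-m) / m, hence has residue 0. The proof below stays within
  power series.\<close>

lemma fps_inverse_power_mult_deriv_nth: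
  fixes u :: "'a::field_char_0 fps"
  assumes "u $ 0 \<noteq> 0"
  shows "(inverse u ^ Suc m * fps_deriv (fps_X * u)) $ m = (if m = 0 then 1 else 0)"
proof (cases m)
  case 0
  then show ?thesis using assms by simp
next
  case (Suc l)
  \<comment> \<open>With \<open>v = 1/u\<close>, the series is \<open>v\<^sup>m + X v\<^sup>m\<^sup>+\<^sup>1 u'\<close> and \<open>(v\<^sup>m)' = - m v\<^sup>m\<^sup>+\<^sup>1 u'\<close>,
    so its coefficients of degree \<open>m\<close> cancel.\<close>
  define v where "v = inverse u"
  have vu: "v * u = 1" using assms by (simp add: v_def inverse_mult_eq_1)
  have expand: "v ^ Suc m * fps_deriv (fps_X * u) = v ^ m + fps_X * (v ^ Suc m * fps_deriv u)"
    using vu by (simp add: algebra_simps)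
  have "fps_deriv v = - fps_deriv u * v\<^sup>2"
    unfolding v_def using fps_inverse_deriv[OF assms] .
  then have "fps_deriv (v ^ m) = - of_nat m * (v ^ Suc m * fps_deriv u)"
    unfolding fps_deriv_power' by (simp add: Suc power2_eq_square mult_ac del: of_nat_Suc)
  then have "fps_deriv (v ^ m) $ l = - of_nat m * (v ^ Suc m * fps_deriv u) $ l"
    by (metis fps_mult_left_const_nth fps_of_nat fps_const_neg)
  then have "of_nat m * ((v ^ m) $ m + (v ^ Suc m * fps_deriv u) $ l) = 0"
    unfolding fps_deriv_nth by (simp add: Suc distrib_left del: power_Suc of_nat_Suc)
  then have "(v ^ m) $ m + (v ^ Suc m * fps_deriv u) $ l = 0"
    by (simp add: Suc del: of_nat_Suc)
  moreover have "(v ^ Suc m * fps_deriv (fps_X * u)) $ m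
      = (v ^ m) $ m + (v ^ Suc m * fps_deriv u) $ l"
    unfolding expand by (simp add: Suc del: power_Suc)
  ultimately show ?thesis by (simp add: Suc v_def del: power_Suc)
qed

text \<open>Expanding (h o f)' = (h' o f) f' in powers of f, the residue computation lets only f^n
  contribute, with the factor h'_n. Taking \<open>h oo f\<close> as the known series avoids the
  inverse of \<open>f\<close> here.\<close>

lemma fps_Lagrange_Buermann:
  fixes f h :: "'a::field_char_0 fps"
  assumes "f $ 0 = 0" "f $ 1 \<noteq> 0"
  shows "of_nat (Suc n) * h $ Suc n
           = (fps_deriv (h oo f) * inverse (fps_shift 1 f) ^ Suc n) $ n"
proof -
  define u where "u = fps_shift 1 f"
  define v where "v = inverse u"
  have u0: "u $ 0 \<noteq> 0" using assms by (simp add: u_def)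
  have uv: "u * v = 1" using u0 by (simp add: v_def inverse_mult_eq_1')
  have f: "f = fps_X * u" using assms(1) by (simp add: u_def fps_eq_iff)
  have coeff: "(f ^ i * (fps_deriv f * v ^ Suc n)) $ n = (if i = n then 1 else 0)"
    if "i \<le> n" for i
  proof -
    \<comment> \<open>Cancelling u^i lowers the exponent of v to n - i + 1, while X^i lowers the
      degree to n - i: the residue lemma applies with \<open>m = n - i\<close>.\<close>
    have "u ^ i * v ^ Suc n = (u * v) ^ i * v ^ Suc (n - i)"
      using that by (simp add: power_mult_distrib flip: power_add power_Suc)
    then have "u ^ i * v ^ Suc n = v ^ Suc (n - i)"
      by (simp add: uv)
    moreover have "f ^ i * (fps_deriv f * v ^ Suc n)
        = fps_X ^ i * (u ^ i * v ^ Suc n * fps_deriv f)"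
      by (subst (1) f) (simp add: power_mult_distrib mult_ac)
    ultimately have "f ^ i * (fps_deriv f * v ^ Suc n)
        = fps_X ^ i * (v ^ Suc (n - i) * fps_deriv f)"
      by (simp only:)
    then have "(f ^ i * (fps_deriv f * v ^ Suc n)) $ n
        = (v ^ Suc (n - i) * fps_deriv f) $ (n - i)"
      using that by (simp only: fps_X_power_mult_nth) simp
    also have "\<dots> = (if i = n then 1 else 0)"
      unfolding v_def by (subst f, subst fps_inverse_power_mult_deriv_nth[OF u0]) (use that in auto)
    finally show ?thesis .
  qed
  have "(fps_deriv (h oo f) * v ^ Suc n) $ n
      = ((fps_deriv h oo f) * (fps_deriv f * v ^ Suc n)) $ n"
    by (simp add: fps_compose_deriv[OF assms(1)] mult.assoc)
  also have "\<dots> = (\<Sum>i=0..n. fps_deriv h $ i * (if i = n then 1 else 0))"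
    unfolding fps_compose_mult_nth[OF assms(1)] by (intro sum.cong) (simp_all add: coeff del: power_Suc)
  also have "\<dots> = of_nat (Suc n) * h $ Suc n"
    by (simp add: if_distrib[of "(*) _"] cong: if_cong)
  finally show ?thesis by (simp add: v_def u_def)
qed

lemma fps_inv_power_nth:
  fixes f :: "'a::field_char_0 fps"
  assumes "f $ 0 = 0" "f $ 1 \<noteq> 0" "0 < k" "k \<le> n"
  shows "of_nat n * (fps_inv f ^ k) $ n
           = of_nat k * (inverse (fps_shift 1 f) ^ n) $ (n - k)"
proof -
  obtain m where n: "n = Suc m" using assms(3,4) by (cases n) auto
  obtain l where k: "k = Suc l" using assms(3) by (cases k) auto
  \<comment> \<open>So \<open>h = fps_inv f ^ k\<close> has (h o f)' = k X^(k-1), which only shifts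
    the coefficient of u^(-n).\<close>
  have "fps_inv f ^ k oo f = fps_X ^ k"
    using assms by (simp add: fps_inv flip: fps_compose_power)
  then have "of_nat n * (fps_inv f ^ k) $ n
      = (fps_deriv (fps_X ^ k) * inverse (fps_shift 1 f) ^ n) $ m"
    using fps_Lagrange_Buermann[OF assms(1,2), of m "fps_inv f ^ k"] by (simp only: n)
  also have "fps_deriv (fps_X ^ k :: 'a fps) = fps_const (of_nat k) * fps_X ^ l"
    by (rule fps_ext) (simp add: k del: power_Suc)
  also have "(\<dots> * inverse (fps_shift 1 f) ^ n) $ m
      = of_nat k * (inverse (fps_shift 1 f) ^ n) $ (n - k)"
    using assms(4) by (simp add: mult.assoc fps_X_power_mult_nth n k)
  finally show ?thesis .
qed


text \<open>Trinomial revision moves all dependence on \<open>i\<close> into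
  \<open>(p + i) choose (p + j)\<close>, and the hockey-stick identity sums that.\<close>

lemma sum_choose_mult_choose:
  "(\<Sum>i=0..m. ((p + i) choose i) * (i choose j)) = ((p + j) choose j) * (Suc (p + m) choose Suc (p + j))"
proof -
  have "((p + i) choose i) * (i choose j) = ((p + j) choose j) * ((p + i) choose (p + j))" for i
  proof (cases "j \<le> i")
    case True
    have "((p + i) choose i) * (i choose j) = ((p + i) choose j) * ((p + i - j) choose (i - j))"
      using True by (simp add: choose_mult)
    also have "(p + i - j) choose (i - j) = (p + i - j) choose p"
      using True by (subst binomial_symmetric) simp_all
    also have "((p + i) choose j) * ((p + i - j) choose p) = ((p + i) choose (p + j)) * ((p + j) choose j)"
      using True choose_mult[of j "p + j" "p + i"] by simp
    finally show ?thesis by simp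
  qed (simp add: binomial_eq_0)
  moreover have "(\<Sum>i=0..m. (p + i) choose (p + j)) = Suc (p + m) choose Suc (p + j)"
    by (induction m) (cases j; simp)+
  ultimately show ?thesis by (simp flip: sum_distrib_left)
qed

lemma fps_inverse_power_nth_expand:
  fixes u :: "'a::field_char_0 fps"
  assumes "u $ 0 = 1" "0 < n"
  shows "(inverse u ^ n) $ m = (\<Sum>j=0..m. (-1) ^ j * of_nat ((n + j - 1) choose j)
           * of_nat ((n + m) choose (m - j)) * (u ^ j) $ m)"
proof -
  obtain p where n: "n = Suc p" using assms(2) by (cases n) auto
  define w where "w = 1 - u"
  \<comment> \<open>The negative binomial series (1 - X)^(-n) with n = p + 1; substituting 1 - u for
    X yields u^(-n).\<close>
  define P :: "'a fps" where "P = Abs_fps (\<lambda>i. of_nat ((p + i) choose i))"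
  have w0: "w $ 0 = 0" using assms by (simp add: w_def)
  have "P = inverse ((1 - fps_X) ^ n)"
    using one_minus_const_fps_X_neg_power'[OF assms(2), where c = "1::'a"] by (simp add: P_def n)
  then have "P oo w = inverse ((1 - fps_X) ^ n oo w)"
    using w0 by (simp add: fps_inverse_compose)
  also have "(1 - fps_X) ^ n oo w = u ^ n"
    using w0 by (simp add: fps_compose_sub_distrib w_def flip: fps_compose_power)
  finally have "inverse u ^ n = P oo w" by (simp add: fps_inverse_power)
  moreover have "(w ^ i) $ m = (\<Sum>j=0..m. of_nat (i choose j) * ((-1) ^ j * (u ^ j) $ m))"
    if "i \<le> m" for i
  proof -
    have "w ^ i = (\<Sum>j\<le>i. of_nat (i choose j) * (- u) ^ j)"
      using binomial_ring[of "- u" 1 i] by (simp add: w_def)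
    also have "\<dots> = (\<Sum>j\<le>i. fps_const (of_nat (i choose j) * (-1) ^ j) * u ^ j)"
      by (intro sum.cong) (simp_all add: power_minus[of u] fps_of_nat mult.assoc
          flip: fps_const_mult fps_const_power fps_const_neg)
    finally have "(w ^ i) $ m = (\<Sum>j\<le>i. of_nat (i choose j) * ((-1) ^ j * (u ^ j) $ m))"
      by (simp add: fps_sum_nth mult.assoc)
    \<comment> \<open>The added terms vanish since j > i; a range independent of \<open>i\<close>
      allows the later exchange of sums.\<close>
    also have "\<dots> = (\<Sum>j=0..m. of_nat (i choose j) * ((-1) ^ j * (u ^ j) $ m))"
      using that by (intro sum.mono_neutral_left) auto
    finally show ?thesis .
  qed
  ultimately have "(inverse u ^ n) $ m = (\<Sum>i=0..m. \<Sum>j=0..m.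
      of_nat (((p + i) choose i) * (i choose j)) * ((-1) ^ j * (u ^ j) $ m))"
    by (simp add: fps_compose_nth P_def sum_distrib_left mult.assoc)
  also have "\<dots> = (\<Sum>j=0..m. of_nat (\<Sum>i=0..m. ((p + i) choose i) * (i choose j))
      * ((-1) ^ j * (u ^ j) $ m))"
    by (subst sum.swap) (simp add: sum_distrib_right)
  also have "\<dots> = (\<Sum>j=0..m. (-1) ^ j * of_nat ((n + j - 1) choose j)
           * of_nat ((n + m) choose (m - j)) * (u ^ j) $ m)"
  proof (intro sum.cong refl)
    fix j assume j: "j \<in> {0..m}"
    then have "Suc (p + m) choose Suc (p + j) = (n + m) choose (m - j)"
      by (subst binomial_symmetric) (simp_all add: n)
    then show "of_nat (\<Sum>i=0..m. ((p + i) choose i) * (i choose j)) * ((-1) ^ j * (u ^ j) $ m)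
      = (-1) ^ j * of_nat ((n + j - 1) choose j) * of_nat ((n + m) choose (m - j)) * (u ^ j) $ m"
      unfolding sum_choose_mult_choose by (simp add: n)
  qed
  finally show ?thesis .
qed

lemma fps_inv_Schloemilch:
  fixes f :: "'a::field_char_0 fps"
  assumes "f $ 0 = 0" "f $ 1 \<noteq> 0" "k \<le> n"
  shows "fact n / fact k * (fps_inv f ^ k) $ n =
    (\<Sum>j=0..n - k. of_nat ((n + j - 1) choose (n + j - k)) * of_nat ((2 * n - k) choose (n - k - j))
       * (-1) ^ j * (f $ 1) powi (- int n - int j)
       * (fact (n - k + j) / fact j * (f ^ j) $ (n - k + j)))"
proof (cases "k = 0")
  case True
  \<comment> \<open>For n > 0 every \<open>(n + j - 1) choose (n + j)\<close> is 0; for n = 0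
    truncated subtraction makes the only binomial \<open>0 choose 0\<close>, giving 1 on both
    sides.\<close>
  then show ?thesis
    by (cases "n = 0") (simp_all add: binomial_eq_0)
next
  case False
  define a where "a = f $ 1"
  define u where "u = fps_const (inverse a) * fps_shift 1 f"
  have a: "a \<noteq> 0" using assms by (simp add: a_def)
  have n: "0 < n" using False assms by simp
  have u0: "u $ 0 = 1" using a by (simp add: u_def a_def)
  have shift: "fps_shift 1 f = fps_const a * u"
    using a by (simp add: u_def flip: mult.assoc)
  have f: "f = fps_X * (fps_const a * u)"
    unfolding shift[symmetric] using assms(1) by (simp add: fps_eq_iff)
  \<comment> \<open>This is the source of the index n - k + j and of the extra factor
    a^(-j).\<close>
  have upow: "(u ^ j) $ m = inverse a ^ j * (f ^ j) $ (m + j)" for j m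
  proof -
    have "f ^ j = fps_X ^ j * (fps_const (a ^ j) * u ^ j)"
      by (subst f) (simp add: power_mult_distrib)
    then have "(f ^ j) $ (m + j) = a ^ j * (u ^ j) $ m"
      by (simp add: fps_X_power_mult_nth)
    then show ?thesis using a by (simp add: field_simps)
  qed
  have "inverse (fps_shift 1 f) ^ n = fps_const (inverse a ^ n) * inverse u ^ n"
    unfolding shift by (simp add: fps_inverse_mult fps_const_inverse a power_mult_distrib)
  then have "of_nat n * (fps_inv f ^ k) $ n
      = of_nat k * (inverse a ^ n * (inverse u ^ n) $ (n - k))"
    using fps_inv_power_nth[OF assms(1,2) _ assms(3)] False by simp
  then have "(fps_inv f ^ k) $ n
      = of_nat k / of_nat n * (inverse a ^ n * (inverse u ^ n) $ (n - k))"
    using n by (simp add: nonzero_eq_divide_eq mult.commute)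
  also have "fact n / fact k * \<dots>
      = fact (n - 1) / fact (k - 1) * (inverse a ^ n * (inverse u ^ n) $ (n - k))"
    using n False by (cases n; cases k) (simp_all del: of_nat_Suc)
  also have "\<dots> = (\<Sum>j=0..n - k. fact (n - 1) / fact (k - 1) * (inverse a ^ n * ((-1) ^ j
      * of_nat ((n + j - 1) choose j) * of_nat ((n + (n - k)) choose (n - k - j))
      * (inverse a ^ j * (f ^ j) $ (n - k + j)))))"
    by (simp add: fps_inverse_power_nth_expand[OF u0 n] upow sum_distrib_left)
  also have "\<dots> = (\<Sum>j=0..n - k. of_nat ((n + j - 1) choose (n + j - k))
       * of_nat ((2 * n - k) choose (n - k - j)) * (-1) ^ j * a powi (- int n - int j)
       * (fact (n - k + j) / fact j * (f ^ j) $ (n - k + j)))"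
  proof (intro sum.cong refl)
    fix j assume "j \<in> {0..n - k}"
    have pw: "a powi (- int n - int j) = inverse a ^ n * inverse a ^ j"
      using a by (simp add: power_int_diff power_int_minus field_simps)
    have nk: "2 * n - k = n + (n - k)" "n + j - k = n - k + j" using assms(3) by auto
    \<comment> \<open>Both sides of the exchange of binomials below equal (n+j-1)! / (j! (k-1)!); it
      supplies the factor (n-k+j)! / j! that normalises the coefficient of f^j.\<close>
    have "of_nat ((n + j - 1) choose (n - k + j)) = (fact (n + j - 1) / (fact (n - k + j) * fact (k - 1)) :: 'a)"
      using False assms(3) by (subst binomial_fact) auto
    moreover have "of_nat ((n + j - 1) choose j) = (fact (n + j - 1) / (fact j * fact (n - 1)) :: 'a)"
      using n by (subst binomial_fact) auto
    ultimately have "fact (n - 1) / fact (k - 1) * of_nat ((n + j - 1) choose j)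
        = (of_nat ((n + j - 1) choose (n - k + j)) * (fact (n - k + j) / fact j) :: 'a)"
      by simp
    then have regroup: "fact (n - 1) / fact (k - 1) * of_nat ((n + j - 1) choose j) * c
        = of_nat ((n + j - 1) choose (n - k + j)) * (fact (n - k + j) / fact j) * c" for c :: 'a
      by simp
    show "fact (n - 1) / fact (k - 1) * (inverse a ^ n * ((-1) ^ j
        * of_nat ((n + j - 1) choose j) * of_nat ((n + (n - k)) choose (n - k - j))
        * (inverse a ^ j * (f ^ j) $ (n - k + j))))
      = of_nat ((n + j - 1) choose (n + j - k)) * of_nat ((2 * n - k) choose (n - k - j)) * (-1) ^ j
        * a powi (- int n - int j) * (fact (n - k + j) / fact j * (f ^ j) $ (n - k + j))"
      unfolding nk pw using regroup[of "inverse a ^ n * ((-1) ^ j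
        * of_nat ((n + (n - k)) choose (n - k - j)) * (inverse a ^ j * (f ^ j) $ (n - k + j)))"] by (simp only: mult_ac)
  qed
  finally show ?thesis by (simp add: a_def)
qed

theorem theorem3p6:
  fixes M :: "'a measure" and Y :: "'a \<Rightarrow> real" and lam r :: real and n k :: nat
  assumes "prob_space M"
    and "Y \<in> borel_measurable M"
    and "r > 0"
    and "\<And>t :: real. \<bar>t\<bar> < r \<Longrightarrow> integrable M (\<lambda>\<omega>. exp (t * Y \<omega>))"
    and "(LINT \<omega>|M. Y \<omega>) \<noteq> 0"
    and "lam \<noteq> 0"
    and "k \<le> n"
  shows "prob_degen_stirling1 M lam Y n k =
    (\<Sum>j = 0..n - k.
       real ((n + j - 1) choose (n + j - k)) * real ((2 * n - k) choose (n - k - j)) *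
       (- 1) ^ j * (LINT \<omega>|M. Y \<omega>) powi (- int n - int j) *
       prob_degen_stirling2 M lam Y (n - k + j) j)"
  \<comment> \<open>The linear coefficient of the delta series is E[Y], and the factorial quotients
    times coefficients are exactly the two kinds of Stirling numbers.\<close>
  using fps_inv_Schloemilch[OF degen_delta_nth_0[OF assms(1)], of lam Y k n] assms(5,7)
  unfolding degen_delta_nth_1
  by (simp add: prob_degen_stirling1_def prob_degen_stirling2_def)

end
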